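(* Let $G$ be a tree of order $n \geq 4$ and let $0 \le \alpha < 1$. Then $$\rho_{D_\alpha}(G) \ge \rho_{D_\alpha}(S_n) = \frac{\alpha n + 2(n-2) + \sqrt{n^2(2-\alpha)^2 + 4(n-1)(2\alpha - 3)}}{2},$$ with equality if and only if $G \cong S_n$.
   Context: For a connected graph $G$ with vertex set $V(G)$, $d_{uv}$ denotes the distance between vertices $u,v$, and the transmission of $u$ is $Tr(u)=\sum_{v\in V(G)} d_{uv}$. $D(G)=(d_{uv})$ is the distance matrix, $Tr(G)$ is the diagonal matrix of vertex transmissions, and the generalized distance matrix is $D_\alpha(G) = \alpha\, Tr(G) + (1-\alpha) D(G)$ for $0 \le \alpha \le 1$. $\rho_{D_\alpha}(G)$ denotes the spectral radius (largest eigenvalue) of $D_\alpha(G)$. $S_n$ denotes the star on $n$ vertices. *)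

theory Defs
  imports Graph_Theory.Graph_Theory Jordan_Normal_Form.Spectral_Radius
begin

text \<open>
  A finite simple graph is a \<^locale>\<open>pair_graph\<close>: a finite loop-free symmetric digraph whose arcs
  are pairs of vertices. The constant \<^const>\<open>Digraph_Component.tree\<close> cannot be used for it,
  because there the closed walk \<open>u, v, u\<close> along a single edge counts as a cycle. An undirected
  cycle has at least three edges.
\<close>

definition undirected_tree :: "'a pair_pre_digraph \<Rightarrow> bool" where
  "undirected_tree G \<longleftrightarrow> pair_graph G \<and> Digraph_Component.connected (with_proj G) \<and>
     \<not> (\<exists>p. pre_digraph.cycle (with_proj G) p \<and> 3 \<le> length p)"

definition star :: "nat \<Rightarrow> nat pair_pre_digraph" where
  "star n = \<lparr>pverts = {..<n}, parcs = {0} \<times> {1..<n} \<union> {1..<n} \<times> {0}\<rparr>"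

definition graph_dist :: "'a pair_pre_digraph \<Rightarrow> 'a \<Rightarrow> 'a \<Rightarrow> real" where
  "graph_dist G u v = real_of_ereal (wf_digraph.\<mu> (with_proj G) (\<lambda>_. 1) u v)"

definition transmission :: "'a pair_pre_digraph \<Rightarrow> 'a \<Rightarrow> real" where
  "transmission G u = (\<Sum>v\<in>pverts G. graph_dist G u v)"

text \<open>
  The rows and columns of the matrices are labelled by an arbitrary but fixed enumeration of the
  vertices. Another enumeration conjugates the matrices by a permutation matrix, so the spectrum
  does not depend on the choice.
\<close>

definition vertex_enum :: "'a pair_pre_digraph \<Rightarrow> 'a list" where
  "vertex_enum G = (SOME vs. distinct vs \<and> set vs = pverts G)"

definition distance_mat :: "'a pair_pre_digraph \<Rightarrow> real mat" where
  "distance_mat G = (let n = card (pverts G); vs = vertex_enum G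
     in mat n n (\<lambda>(i, j). graph_dist G (vs ! i) (vs ! j)))"

definition transmission_mat :: "'a pair_pre_digraph \<Rightarrow> real mat" where
  "transmission_mat G = (let n = card (pverts G); vs = vertex_enum G
     in mat n n (\<lambda>(i, j). if i = j then transmission G (vs ! i) else 0))"

definition gen_distance_mat :: "real \<Rightarrow> 'a pair_pre_digraph \<Rightarrow> real mat" where
  "gen_distance_mat \<alpha> G = \<alpha> \<cdot>\<^sub>m transmission_mat G + (1 - \<alpha>) \<cdot>\<^sub>m distance_mat G"

text \<open>
  The matrix is real symmetric, so its spectral radius in the sense used here, the largest
  eigenvalue, is the maximum of its real spectrum; this set is finite and, for a nonempty graph,
  nonempty (\<open>gen_distance_radius_eigenvalue\<close> below).
\<close>

definition gen_distance_radius :: "real \<Rightarrow> 'a pair_pre_digraph \<Rightarrow> real" where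
  "gen_distance_radius \<alpha> G = Max (spectrum (gen_distance_mat \<alpha> G))"

lemma pair_graph_star: "pair_graph (star n)"
  by unfold_locales (auto simp: star_def symmetric_def sym_def arcs_ends_def)

lemma vertex_enum:
  assumes "finite (pverts G)"
  shows "distinct (vertex_enum G)" "set (vertex_enum G) = pverts G"
    "length (vertex_enum G) = card (pverts G)"
proof -
  have "\<exists>vs. distinct vs \<and> set vs = pverts G"
    using finite_distinct_list[OF assms] by blast
  then have "distinct (vertex_enum G) \<and> set (vertex_enum G) = pverts G"
    unfolding vertex_enum_def by (rule someI_ex)
  then show "distinct (vertex_enum G)" "set (vertex_enum G) = pverts G"
    "length (vertex_enum G) = card (pverts G)"
    by (auto simp: distinct_card[symmetric])
qed

lemma graph_dist_eq_Least:
  assumes "pair_graph G" and "pre_digraph.awalk (with_proj G) u p v"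
  shows "graph_dist G u v =
    real (LEAST k. \<exists>p. pre_digraph.awalk (with_proj G) u p v \<and> length p = k)"
proof -
  interpret pair_graph G by fact
  let ?P = "\<lambda>k. \<exists>p. awalk u p v \<and> length p = k"
  have cost: "awalk_cost (\<lambda>_. 1) p = real (length p)" for p
    by (induction p) (auto simp: awalk_cost_def)
  obtain q where q: "awalk u q v" "length q = (LEAST k. ?P k)"
    using LeastI[of ?P "length p"] assms(2) by auto
  have le: "(LEAST k. ?P k) \<le> length r" if "awalk u r v" for r
    by (rule Least_le) (use that in auto)
  have "\<mu> (\<lambda>_. 1) u v = ereal (real (LEAST k. ?P k))"
  proof (rule antisym)
    show "\<mu> (\<lambda>_. 1) u v \<le> ereal (real (LEAST k. ?P k))"
      using min_cost_le_walk_cost[OF q(1), of "\<lambda>_. 1"] unfolding cost q(2) .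
    show "ereal (real (LEAST k. ?P k)) \<le> \<mu> (\<lambda>_. 1) u v"
      unfolding \<mu>_def
    proof (rule INF_greatest)
      fix r assume "r \<in> {p. awalk u p v}"
      then show "ereal (real (LEAST k. ?P k)) \<le> ereal (awalk_cost (\<lambda>_. 1) r)"
        unfolding cost using le by simp
    qed
  qed
  then show ?thesis unfolding graph_dist_def by simp
qed

lemma graph_dist_commute:
  assumes "pair_graph G"
  shows "graph_dist G u v = graph_dist G v u"
proof -
  interpret pair_graph G by fact
  have cost: "awalk_cost (\<lambda>_. 1) p = real (length p)" for p
    by (induction p) (auto simp: awalk_cost_def)
  have swap: "prod.swap e \<in> parcs G" if "e \<in> parcs G" for e
    using that arcs_symmetric by (cases e) auto
  have rev: "awalk b (rev (map prod.swap p)) a" if "awalk a p b" for a p b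
    using that
  proof (induction p arbitrary: a)
    case Nil
    then show ?case by (auto simp: awalk_Nil_iff)
  next
    case (Cons e p)
    then have e: "e \<in> parcs G" "fst e = a" and p: "awalk (snd e) p b"
      by (auto simp: awalk_Cons_iff)
    have "awalk (snd e) [prod.swap e] a"
      using swap[OF e(1)] e in_arcsD1 in_arcsD2
      by (cases e) (auto simp: awalk_Cons_iff awalk_Nil_iff)
    with Cons.IH[OF p] show ?case by (auto simp: awalk_append_iff intro: awalk_appendI)
  qed
  have le: "\<mu> (\<lambda>_. 1) a b \<le> \<mu> (\<lambda>_. 1) b a" for a b
    unfolding \<mu>_def[of _ b a]
  proof (rule INF_greatest)
    fix r assume "r \<in> {p. awalk b p a}"
    then show "\<mu> (\<lambda>_. 1) a b \<le> ereal (awalk_cost (\<lambda>_. 1) r)"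
      using min_cost_le_walk_cost[OF rev, of b r a "\<lambda>_. 1"] by (simp add: cost)
  qed
  have "\<mu> (\<lambda>_. 1) u v = \<mu> (\<lambda>_. 1) v u"
    by (rule antisym) (rule le)+
  then show ?thesis unfolding graph_dist_def by simp
qed

lemma spectrum_real_symmetric_nonempty:
  fixes A :: "real mat"
  assumes A: "A \<in> carrier_mat n n" and n: "n > 0"
    and sym: "\<And>i j. i < n \<Longrightarrow> j < n \<Longrightarrow> A $$ (i, j) = A $$ (j, i)"
  shows "spectrum A \<noteq> {}"
proof -
  let ?C = "map_mat complex_of_real A"
  have C: "?C \<in> carrier_mat n n" using A by simp
  obtain k where k: "k \<in> spectrum ?C"
    using spectrum_non_empty[OF C n] by auto
  then obtain v where v: "v \<in> carrier_vec n" "v \<noteq> 0\<^sub>v n" "?C *\<^sub>v v = k \<cdot>\<^sub>v v"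
    using A by (auto simp: spectrum_def eigenvalue_def eigenvector_def)
  have row: "(\<Sum>j<n. complex_of_real (A $$ (i, j)) * v $ j) = k * v $ i" if "i < n" for i
  proof -
    have "(?C *\<^sub>v v) $ i = (\<Sum>j<n. complex_of_real (A $$ (i, j)) * v $ j)"
      using A v(1) that by (auto simp: scalar_prod_def atLeast0LessThan intro!: sum.cong)
    then show ?thesis using v that by simp
  qed
  define S where "S = (\<Sum>i<n. cnj (v $ i) * v $ i)"
  define T where "T = (\<Sum>i<n. cnj (v $ i) * (\<Sum>j<n. complex_of_real (A $$ (i, j)) * v $ j))"
  have T: "T = k * S"
    unfolding T_def S_def sum_distrib_left[of k]
    by (rule sum.cong) (simp_all add: row mult.left_commute)
  have "cnj T = (\<Sum>i<n. \<Sum>j<n. v $ i * (complex_of_real (A $$ (i, j)) * cnj (v $ j)))"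
    unfolding T_def by (simp add: sum_distrib_left)
  also have "\<dots> = (\<Sum>j<n. \<Sum>i<n. v $ i * (complex_of_real (A $$ (i, j)) * cnj (v $ j)))"
    by (rule sum.swap)
  also have "\<dots> = T"
    unfolding T_def sum_distrib_left by (intro sum.cong) (auto simp: sym)
  finally have "cnj T = T" .
  moreover have S: "S = complex_of_real (\<Sum>i<n. (cmod (v $ i))\<^sup>2)"
    unfolding S_def of_real_sum
    by (rule sum.cong[OF refl]) (metis complex_norm_square mult.commute)
  moreover have "S \<noteq> 0"
  proof
    assume "S = 0"
    then have "(\<Sum>i<n. (cmod (v $ i))\<^sup>2) = 0" using S by (metis of_real_eq_0_iff)
    then have "\<forall>i<n. v $ i = 0"
      by (subst (asm) sum_nonneg_eq_0_iff) auto
    then have "v = 0\<^sub>v n" using v(1) by (intro eq_vecI) auto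
    with v(2) show False by simp
  qed
  moreover have "cnj S = S" unfolding S by simp
  ultimately have "cnj k = k" using T by auto
  then obtain x where x: "k = complex_of_real x"
    by (metis Reals_cnj_iff Reals_cases)
  have "poly (char_poly ?C) k = 0"
    using k spectrum_root_char_poly[OF C] by auto
  then have "poly (char_poly A) x = 0"
    unfolding x of_real_hom.char_poly_hom[OF A] by simp
  then show ?thesis using spectrum_root_char_poly[OF A] by auto
qed

lemma gen_distance_radius_eigenvalue:
  assumes "pair_graph G" and "pverts G \<noteq> {}"
  shows "eigenvalue (gen_distance_mat \<alpha> G) (gen_distance_radius \<alpha> G)"
    and "eigenvalue (gen_distance_mat \<alpha> G) k \<Longrightarrow> k \<le> gen_distance_radius \<alpha> G"
proof -
  interpret pair_graph G by fact
  let ?n = "card (pverts G)"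
  have n: "?n > 0" using assms(2) pair_finite_verts by (simp add: card_gt_0_iff)
  have A: "gen_distance_mat \<alpha> G \<in> carrier_mat ?n ?n"
    by (simp add: gen_distance_mat_def transmission_mat_def distance_mat_def Let_def)
  have "spectrum (gen_distance_mat \<alpha> G) \<noteq> {}"
    by (rule spectrum_real_symmetric_nonempty[OF A n])
      (use graph_dist_commute[OF assms(1)] in
        \<open>auto simp: gen_distance_mat_def transmission_mat_def distance_mat_def Let_def\<close>)
  note ne = this and fin = card_finite_spectrum(1)[OF A]
  show "eigenvalue (gen_distance_mat \<alpha> G) (gen_distance_radius \<alpha> G)"
    using Max_in[OF fin ne] by (simp add: gen_distance_radius_def spectrum_def)
  show "k \<le> gen_distance_radius \<alpha> G" if "eigenvalue (gen_distance_mat \<alpha> G) k"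
    using Max_ge[OF fin] that by (simp add: gen_distance_radius_def spectrum_def)
qed

end

(*
  By compactness of the unit sphere the largest eigenvalue of a real symmetric matrix bounds its
  Rayleigh quotients from above, while a positive eigenvector of a nonnegative symmetric matrix
  belongs to the largest eigenvalue. Let x and y be the entries of the Perron vector of the star at
  the centre and at the leaves. In a tree G choose a vertex c of degree at least 2 and test D_alpha(G)
  with the vector that is x at c and y elsewhere. Its quadratic form is
    (sum of d(c,v)) * (alpha x^2 + alpha y^2 + 2 (1 - alpha) x y) + (sum of d(u,v) over u, v != c) * y^2.
  The first sum is at least n - 1, its value for the star, with equality only if c is adjacent to all
  vertices. For the second, an arc from a vertex w of depth at least 2 to its parent loses 1 against
  the value 2 of the star, and the pair of w with a neighbour of c on another branch, at distance at
  least 3, makes up for it. So the Rayleigh quotient of G exceeds the radius of the star unless G is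
  a star.
*)
theory Submission
  imports Defs "HOL-Analysis.Function_Topology"
begin

section \<open>The largest eigenvalue\<close>

text \<open>A maximiser of the form on the unit sphere is an eigenvector, and by homogeneity its
  value \<open>k\<close> bounds the form everywhere. Functions on a finite set stand in for vectors
  so that vertices can serve as indices.\<close>

lemma symmetric_form_max_eigenvector:
  fixes a :: "'b \<Rightarrow> 'b \<Rightarrow> real"
  assumes fin: "finite A" and ne: "A \<noteq> {}"
    and sym: "\<And>i j. i \<in> A \<Longrightarrow> j \<in> A \<Longrightarrow> a i j = a j i"
  obtains k x where "\<exists>i\<in>A. x i \<noteq> 0" "\<And>i. i \<in> A \<Longrightarrow> (\<Sum>j\<in>A. a i j * x j) = k * x i"
    "\<And>y. (\<Sum>i\<in>A. \<Sum>j\<in>A. a i j * y i * y j) \<le> k * (\<Sum>i\<in>A. (y i)\<^sup>2)"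
proof -
  define Q where "Q y = (\<Sum>i\<in>A. \<Sum>j\<in>A. a i j * y i * y j)" for y :: "'b \<Rightarrow> real"
  define N where "N y = (\<Sum>i\<in>A. (y i)\<^sup>2)" for y :: "'b \<Rightarrow> real"
  \<comment> \<open>Coordinates outside \<open>A\<close> are pinned to 0, so \<open>C\<close> is a
    product of compact sets, compact by Tychonoff even over an infinite type. The box contains the
    unit sphere.\<close>
  define C where "C = PiE (UNIV::'b set) (\<lambda>i. if i \<in> A then {-1..1::real} else {0})"
  define S where "S = C \<inter> {y. N y = 1}"
  have "compactin (product_topology (\<lambda>_. euclidean) UNIV) C"
    unfolding C_def compactin_PiE by auto
  then have cC: "compact C"
    unfolding euclidean_product_topology by simp
  have contN: "continuous_on UNIV N" unfolding N_def
    by (intro continuous_intros continuous_on_product_coordinates)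
  have contQ: "continuous_on UNIV Q" unfolding Q_def
    by (intro continuous_intros continuous_on_product_coordinates)
  have "closed {y. N y = 1}"
    using contN by (intro closed_Collect_eq continuous_on_const)
  then have cS: "compact S" unfolding S_def using cC by (rule compact_Int_closed[rotated])
  obtain e where e: "e \<in> A" using ne by auto
  have "(\<lambda>i. if i = e then 1 else 0) \<in> S"
    using e fin by (auto simp: S_def C_def N_def if_distrib[of "\<lambda>x. x\<^sup>2"] cong: if_cong)
  then have "S \<noteq> {}" by auto
  then obtain x where x: "x \<in> S" and max: "\<And>y. y \<in> S \<Longrightarrow> Q y \<le> Q x"
    using continuous_attains_sup[OF cS _ continuous_on_subset[OF contQ]] by blast
  define k where "k = Q x"
  have Nx: "N x = 1" using x by (simp add: S_def)
  have N0: "N y \<ge> 0" for y unfolding N_def by (simp add: sum_nonneg)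
  have Ni: "(y i)\<^sup>2 \<le> N y" if "i \<in> A" for y i
    unfolding N_def by (rule member_le_sum) (use that fin in auto)
  have bound: "Q y \<le> k * N y" for y
  proof (cases "N y = 0")
    case True
    then have "y i = 0" if "i \<in> A" for i using Ni[OF that, of y] by simp
    then have "Q y = 0" unfolding Q_def by simp
    with True show ?thesis by simp
  next
    case False
    then have pos: "N y > 0" using N0[of y] by simp
    define s where "s = sqrt (N y)"
    have s: "s > 0" "s\<^sup>2 = N y" using pos by (auto simp: s_def)
    define z where "z i = (if i \<in> A then y i / s else 0)" for i
    have Nz: "N z = N y / s\<^sup>2"
      unfolding N_def sum_divide_distrib by (rule sum.cong) (auto simp: z_def power_divide)
    then have Nz: "N z = 1" using s pos by simp
    have "\<bar>z i\<bar> \<le> 1" if "i \<in> A" for i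
      using Ni[OF that, of z] Nz by (simp add: abs_square_le_1)
    then have "z i \<in> {-1..1}" if "i \<in> A" for i using that by (auto simp: abs_le_iff minus_le_iff)
    then have "z \<in> C" unfolding C_def by (simp add: PiE_iff) (simp add: z_def)
    with Nz have "Q z \<le> k" using max unfolding k_def S_def by auto
    moreover have "Q z = Q y / s\<^sup>2"
      unfolding Q_def sum_divide_distrib
      by (intro sum.cong) (auto simp: z_def power2_eq_square)
    ultimately show ?thesis using s pos by (simp add: pos_divide_le_eq)
  qed
  define r where "r i = (\<Sum>j\<in>A. a i j * x j) - k * x i" for i
  have Qt: "Q (\<lambda>i. x i + t * r i) = Q x + 2 * t * (\<Sum>i\<in>A. r i * (\<Sum>j\<in>A. a i j * x j)) + t\<^sup>2 * Q r" for t
  proof -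
    have "(\<Sum>i\<in>A. \<Sum>j\<in>A. a i j * x i * r j) = (\<Sum>j\<in>A. \<Sum>i\<in>A. a i j * x i * r j)"
      by (rule sum.swap)
    also have "\<dots> = (\<Sum>i\<in>A. r i * (\<Sum>j\<in>A. a i j * x j))"
      unfolding sum_distrib_left by (intro sum.cong) (auto simp: sym)
    finally have 1: "(\<Sum>i\<in>A. \<Sum>j\<in>A. a i j * x i * r j) = (\<Sum>i\<in>A. r i * (\<Sum>j\<in>A. a i j * x j))" .
    have 2: "(\<Sum>i\<in>A. \<Sum>j\<in>A. a i j * r i * x j) = (\<Sum>i\<in>A. r i * (\<Sum>j\<in>A. a i j * x j))"
      unfolding sum_distrib_left by (intro sum.cong) auto
    have "Q (\<lambda>i. x i + t * r i) = Q x + t * (\<Sum>i\<in>A. \<Sum>j\<in>A. a i j * x i * r j)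
        + t * (\<Sum>i\<in>A. \<Sum>j\<in>A. a i j * r i * x j) + t\<^sup>2 * Q r"
      unfolding Q_def sum_distrib_left sum.distrib[symmetric]
      by (intro sum.cong) (auto simp: algebra_simps power2_eq_square)
    then show ?thesis unfolding 1 2 by simp
  qed
  have Nt: "N (\<lambda>i. x i + t * r i) = N x + 2 * t * (\<Sum>i\<in>A. r i * x i) + t\<^sup>2 * N r" for t
    unfolding N_def sum_distrib_left sum.distrib[symmetric]
    by (intro sum.cong) (auto simp: algebra_simps power2_eq_square)
  have rr: "(\<Sum>i\<in>A. r i * (\<Sum>j\<in>A. a i j * x j)) - k * (\<Sum>i\<in>A. r i * x i) = N r"
    unfolding N_def sum_distrib_left[of k] sum_subtractf[symmetric]
    by (intro sum.cong) (auto simp: r_def algebra_simps power2_eq_square)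
  \<comment> \<open>First variation of the Rayleigh quotient at its maximum \<open>x\<close>, in the direction of the residual \<open>r\<close>.\<close>
  have key: "2 * t * N r \<le> t\<^sup>2 * (k * N r - Q r)" for t
    using bound[of "\<lambda>i. x i + t * r i"] unfolding Qt Nt Nx rr[symmetric] k_def[symmetric]
    by (simp add: algebra_simps)
  have "N r = 0"
  proof (rule ccontr)
    assume "N r \<noteq> 0"
    then have pos: "N r > 0" using N0[of r] by simp
    define c where "c = k * N r - Q r"
    have "c > 0" using key[of 1] pos unfolding c_def by simp
    \<comment> \<open>This \<open>t\<close> minimises \<open>t^2 * c - 2 * t * N r\<close>. The
      minimum is negative, while \<open>key\<close> requires it to be nonnegative.\<close>
    with key[of "N r / c"] pos show False
      unfolding c_def[symmetric] by (simp add: power2_eq_square field_simps)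
  qed
  then have "r i = 0" if "i \<in> A" for i using Ni[OF that, of r] by simp
  then have "(\<Sum>j\<in>A. a i j * x j) = k * x i" if "i \<in> A" for i using that by (simp add: r_def)
  moreover have "\<exists>i\<in>A. x i \<noteq> 0"
  proof (rule ccontr)
    assume "\<not> ?thesis"
    then have "N x = 0" by (simp add: N_def)
    with Nx show False by simp
  qed
  ultimately show ?thesis using that bound unfolding Q_def N_def by blast
qed

section \<open>The spectrum of D_alpha through functions on the vertices\<close>

definition gen_dist :: "real \<Rightarrow> 'a pair_pre_digraph \<Rightarrow> 'a \<Rightarrow> 'a \<Rightarrow> real" where
  "gen_dist \<alpha> G u v = (if u = v then \<alpha> * transmission G u else 0) + (1 - \<alpha>) * graph_dist G u v"

text \<open>Reindexing along the enumeration turns vectors into functions on the vertices, which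
  frees the later arguments from \<open>vertex_enum\<close>.\<close>

lemma eigenvalue_gen_distance_mat_iff:
  assumes "finite (pverts G)"
  shows "eigenvalue (gen_distance_mat \<alpha> G) k \<longleftrightarrow> (\<exists>z. (\<exists>u\<in>pverts G. z u \<noteq> 0) \<and>
    (\<forall>u\<in>pverts G. (\<Sum>v\<in>pverts G. gen_dist \<alpha> G u v * z v) = k * z u))"
proof -
  let ?V = "pverts G" and ?M = "gen_distance_mat \<alpha> G"
  define n where "n = card ?V"
  define vs where "vs = vertex_enum G"
  have vs: "distinct vs" "set vs = ?V" "length vs = n"
    using vertex_enum[OF assms] by (auto simp: vs_def n_def)
  have bij: "bij_betw ((!) vs) {..<n} ?V"
    using bij_betw_nth[OF vs(1), of "{..<n}" ?V] vs by auto
  have M: "?M \<in> carrier_mat n n"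
    by (simp add: gen_distance_mat_def transmission_mat_def distance_mat_def Let_def n_def)
  have ent: "?M $$ (i, j) = gen_dist \<alpha> G (vs ! i) (vs ! j)" if "i < n" "j < n" for i j
    using that vs nth_eq_iff_index_eq[OF vs(1)]
    by (auto simp: gen_distance_mat_def transmission_mat_def distance_mat_def Let_def n_def
        gen_dist_def vs_def[symmetric])
  have row: "(?M *\<^sub>v x) $ i = (\<Sum>v\<in>?V. gen_dist \<alpha> G (vs ! i) v * z v)"
    if "i < n" and "x \<in> carrier_vec n" and "\<And>j. j < n \<Longrightarrow> x $ j = z (vs ! j)" for x z i
  proof -
    have "(?M *\<^sub>v x) $ i = (\<Sum>j<n. ?M $$ (i, j) * x $ j)"
      using M that by (auto simp: scalar_prod_def atLeast0LessThan intro!: sum.cong)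
    also have "\<dots> = (\<Sum>j<n. gen_dist \<alpha> G (vs ! i) (vs ! j) * z (vs ! j))"
      using that by (intro sum.cong) (auto simp: ent)
    also have "\<dots> = (\<Sum>v\<in>?V. gen_dist \<alpha> G (vs ! i) v * z v)"
      by (rule sum.reindex_bij_betw[OF bij])
    finally show ?thesis .
  qed
  have V: "u \<in> ?V \<longleftrightarrow> (\<exists>i<n. u = vs ! i)" for u
    using vs(2,3) by (metis in_set_conv_nth)
  show ?thesis
  proof
    assume "eigenvalue ?M k"
    then obtain x where x: "x \<in> carrier_vec n" "x \<noteq> 0\<^sub>v n" "?M *\<^sub>v x = k \<cdot>\<^sub>v x"
      using M by (auto simp: eigenvalue_def eigenvector_def)
    define z where "z u = x $ the_inv_into {..<n} ((!) vs) u" for u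
    have z: "x $ j = z (vs ! j)" if "j < n" for j
      using that the_inv_into_f_f[OF bij_betw_imp_inj_on[OF bij]] by (simp add: z_def)
    have "\<exists>i<n. x $ i \<noteq> 0"
      using x(1,2) by (auto intro!: eq_vecI)
    then obtain i where "i < n" "z (vs ! i) \<noteq> 0" using z by auto
    then have "\<exists>u\<in>?V. z u \<noteq> 0" using V by blast
    moreover have "(\<Sum>v\<in>?V. gen_dist \<alpha> G u v * z v) = k * z u" if u: "u \<in> ?V" for u
    proof -
      obtain i where i: "i < n" "u = vs ! i" using u unfolding V by blast
      have "(?M *\<^sub>v x) $ i = k * x $ i" using x i by simp
      then show ?thesis using row[OF i(1) x(1) z] i z by simp
    qed
    ultimately show "\<exists>z. (\<exists>u\<in>?V. z u \<noteq> 0) \<and>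
      (\<forall>u\<in>?V. (\<Sum>v\<in>?V. gen_dist \<alpha> G u v * z v) = k * z u)" by blast
  next
    assume "\<exists>z. (\<exists>u\<in>?V. z u \<noteq> 0) \<and> (\<forall>u\<in>?V. (\<Sum>v\<in>?V. gen_dist \<alpha> G u v * z v) = k * z u)"
    then obtain z where z: "\<exists>u\<in>?V. z u \<noteq> 0"
      "\<And>u. u \<in> ?V \<Longrightarrow> (\<Sum>v\<in>?V. gen_dist \<alpha> G u v * z v) = k * z u" by blast
    define x where "x = vec n (\<lambda>i. z (vs ! i))"
    have x: "x \<in> carrier_vec n" "\<And>j. j < n \<Longrightarrow> x $ j = z (vs ! j)" by (auto simp: x_def)
    have "?M *\<^sub>v x = k \<cdot>\<^sub>v x"
    proof (rule eq_vecI)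
      show "dim_vec (?M *\<^sub>v x) = dim_vec (k \<cdot>\<^sub>v x)" using M x(1) by simp
      fix i assume "i < dim_vec (k \<cdot>\<^sub>v x)"
      then have i: "i < n" using x(1) by simp
      show "(?M *\<^sub>v x) $ i = (k \<cdot>\<^sub>v x) $ i"
      proof -
        have "vs ! i \<in> ?V" using i V by blast
        from z(2)[OF this] show ?thesis using row[OF i x] i x by simp
      qed
    qed
    moreover have "x \<noteq> 0\<^sub>v n"
    proof
      assume "x = 0\<^sub>v n"
      then have "z (vs ! j) = 0" if "j < n" for j using x(2)[OF that] that by simp
      with z(1) show False using V by auto
    qed
    ultimately show "eigenvalue ?M k"
      using M x(1) unfolding eigenvalue_def eigenvector_def by auto
  qed
qed

lemma gen_dist_commute:
  "pair_graph G \<Longrightarrow> gen_dist \<alpha> G u v = gen_dist \<alpha> G v u"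
  by (auto simp: gen_dist_def graph_dist_commute)

text \<open>The maximum \<open>k\<close> of the form on the unit sphere is an eigenvalue, hence at
  most the radius, and the sum of squares is nonnegative.\<close>

lemma quadratic_form_le_radius:
  assumes G: "pair_graph G" and ne: "pverts G \<noteq> {}"
  shows "(\<Sum>u\<in>pverts G. \<Sum>v\<in>pverts G. gen_dist \<alpha> G u v * y u * y v)
    \<le> gen_distance_radius \<alpha> G * (\<Sum>u\<in>pverts G. (y u)\<^sup>2)"
proof -
  interpret pair_graph G by fact
  obtain k x where k: "\<exists>u\<in>pverts G. x u \<noteq> 0"
    "\<And>u. u \<in> pverts G \<Longrightarrow> (\<Sum>v\<in>pverts G. gen_dist \<alpha> G u v * x v) = k * x u"
    "\<And>y. (\<Sum>u\<in>pverts G. \<Sum>v\<in>pverts G. gen_dist \<alpha> G u v * y u * y v) \<le> k * (\<Sum>u\<in>pverts G. (y u)\<^sup>2)"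
    by (rule symmetric_form_max_eigenvector[OF pair_finite_verts ne, of "gen_dist \<alpha> G"])
      (auto simp: gen_dist_commute[OF G])
  have "eigenvalue (gen_distance_mat \<alpha> G) k"
    unfolding eigenvalue_gen_distance_mat_iff[OF pair_finite_verts] using k(1,2) by blast
  then have "k \<le> gen_distance_radius \<alpha> G" by (rule gen_distance_radius_eigenvalue(2)[OF G ne])
  then show ?thesis
    using k(3)[of y] by (meson mult_right_mono order_trans sum_nonneg zero_le_power2)
qed

text \<open>Let z be an eigenvector for the radius r. Nonnegative entries give r |z| \<le> A |z|,
  and pairing with w moves the symmetric A onto w, so r (w, |z|) \<le> k (w, |z|). The pairing is
  positive because w is.\<close>

lemma radius_eqI_positive_eigenvector:
  assumes G: "pair_graph G" and ne: "pverts G \<noteq> {}"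
    and nonneg: "\<And>u v. u \<in> pverts G \<Longrightarrow> v \<in> pverts G \<Longrightarrow> gen_dist \<alpha> G u v \<ge> 0"
    and pos: "\<And>u. u \<in> pverts G \<Longrightarrow> w u > 0"
    and w: "\<And>u. u \<in> pverts G \<Longrightarrow> (\<Sum>v\<in>pverts G. gen_dist \<alpha> G u v * w v) = k * w u"
  shows "gen_distance_radius \<alpha> G = k"
proof (rule antisym)
  interpret pair_graph G by fact
  let ?V = "pverts G" and ?r = "gen_distance_radius \<alpha> G"
  have "\<exists>u\<in>?V. w u \<noteq> 0" using ne pos by (metis ex_in_conv less_irrefl)
  then have "eigenvalue (gen_distance_mat \<alpha> G) k"
    unfolding eigenvalue_gen_distance_mat_iff[OF pair_finite_verts] using w by blast
  then show "k \<le> ?r" by (rule gen_distance_radius_eigenvalue(2)[OF G ne])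
  obtain z where z: "\<exists>u\<in>?V. z u \<noteq> 0"
    "\<And>u. u \<in> ?V \<Longrightarrow> (\<Sum>v\<in>?V. gen_dist \<alpha> G u v * z v) = ?r * z u"
    using gen_distance_radius_eigenvalue(1)[OF G ne, of \<alpha>]
    unfolding eigenvalue_gen_distance_mat_iff[OF pair_finite_verts] by blast
  have le: "?r * \<bar>z u\<bar> \<le> (\<Sum>v\<in>?V. gen_dist \<alpha> G u v * \<bar>z v\<bar>)" if u: "u \<in> ?V" for u
  proof -
    \<comment> \<open>Valid for either sign of the radius.\<close>
    have "?r * \<bar>z u\<bar> \<le> \<bar>?r * z u\<bar>" by (simp add: abs_mult mult_right_mono)
    also have "\<dots> = \<bar>\<Sum>v\<in>?V. gen_dist \<alpha> G u v * z v\<bar>" using z(2)[OF u] by simp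
    also have "\<dots> \<le> (\<Sum>v\<in>?V. \<bar>gen_dist \<alpha> G u v * z v\<bar>)" by (rule sum_abs)
    also have "\<dots> = (\<Sum>v\<in>?V. gen_dist \<alpha> G u v * \<bar>z v\<bar>)"
      using nonneg[OF u] by (intro sum.cong) (auto simp: abs_mult)
    finally show ?thesis .
  qed
  have "?r * (\<Sum>u\<in>?V. w u * \<bar>z u\<bar>) = (\<Sum>u\<in>?V. w u * (?r * \<bar>z u\<bar>))"
    by (simp add: sum_distrib_left mult.left_commute)
  also have "\<dots> \<le> (\<Sum>u\<in>?V. w u * (\<Sum>v\<in>?V. gen_dist \<alpha> G u v * \<bar>z v\<bar>))"
    using le pos by (intro sum_mono mult_left_mono) (auto intro: less_imp_le)
  also have "\<dots> = (\<Sum>u\<in>?V. \<Sum>v\<in>?V. \<bar>z v\<bar> * (gen_dist \<alpha> G v u * w u))"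
    unfolding sum_distrib_left
    by (intro sum.cong) (auto simp: gen_dist_commute[OF G])
  also have "\<dots> = (\<Sum>v\<in>?V. \<Sum>u\<in>?V. \<bar>z v\<bar> * (gen_dist \<alpha> G v u * w u))"
    by (rule sum.swap)
  also have "\<dots> = (\<Sum>v\<in>?V. \<bar>z v\<bar> * (k * w v))"
    unfolding sum_distrib_left[symmetric] by (intro sum.cong) (auto simp: w)
  also have "\<dots> = k * (\<Sum>u\<in>?V. w u * \<bar>z u\<bar>)"
    by (simp add: sum_distrib_left mult_ac)
  finally have fin: "?r * (\<Sum>u\<in>?V. w u * \<bar>z u\<bar>) \<le> k * (\<Sum>u\<in>?V. w u * \<bar>z u\<bar>)" .
  obtain u where u: "u \<in> ?V" "z u \<noteq> 0" using z(1) by blast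
  have "0 < (\<Sum>u\<in>?V. w u * \<bar>z u\<bar>)"
    by (rule sum_pos2[OF pair_finite_verts u(1)]) (use u pos in \<open>auto intro!: mult_nonneg_nonneg simp: less_imp_le\<close>)
  with fin show "?r \<le> k" by simp
qed

section \<open>Distances in rooted trees\<close>

lemma graph_dist_le_length:
  assumes "pair_graph G" and "pre_digraph.awalk (with_proj G) u p v"
  shows "graph_dist G u v \<le> real (length p)"
  unfolding graph_dist_eq_Least[OF assms] of_nat_le_iff
  by (rule Least_le) (use assms(2) in blast)

text \<open>Connectivity provides a shortest walk between any two vertices. Acyclicity is added in a
  later locale, so the star enters here through its connectivity.\<close>

locale connected_pair_graph = pair_graph +
  assumes conn: "Digraph_Component.connected (with_proj G)"
begin

lemma graph_dist_awalk:
  assumes "u \<in> pverts G" and "v \<in> pverts G"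
  obtains p where "awalk u p v" "graph_dist G u v = real (length p)"
proof -
  have "strongly_connected (with_proj G)"
    using symmetric_connected_imp_strongly_connected[OF _ conn] pair_sym_arcs by simp
  then have "u \<rightarrow>\<^sup>*\<^bsub>with_proj G\<^esub> v"
    using assms by (auto simp: strongly_connected_def)
  then obtain q where q: "awalk u q v" by (auto simp: reachable_awalk)
  let ?P = "\<lambda>k. \<exists>p. awalk u p v \<and> length p = k"
  obtain p where "awalk u p v" "length p = (LEAST k. ?P k)"
    using LeastI[of ?P "length q"] q by auto
  with that show ?thesis using graph_dist_eq_Least[OF pair_graph q] by simp
qed

text \<open>Along a walk the increments of \<open>h\<close> add up to at most its length. Lower
  bounds on distances come from this by a suitable choice of \<open>h\<close>.\<close>

lemma lipschitz_le_graph_dist: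
  fixes h :: "'a \<Rightarrow> real"
  assumes h: "\<And>a b. (a, b) \<in> parcs G \<Longrightarrow> h b \<le> h a + 1"
    and "u \<in> pverts G" and "v \<in> pverts G"
  shows "h v - h u \<le> graph_dist G u v"
proof -
  have walk: "h v - h a \<le> real (length p)" if "awalk a p v" for a p
    using that
  proof (induction p arbitrary: a)
    case Nil
    then show ?case by (auto simp: awalk_Nil_iff)
  next
    case (Cons e p)
    then have "e \<in> parcs G" "fst e = a" "awalk (snd e) p v"
      by (auto simp: awalk_Cons_iff)
    with Cons.IH[of "snd e"] h[of a "snd e"] show ?case by (cases e) auto
  qed
  obtain p where "awalk u p v" "graph_dist G u v = real (length p)"
    using graph_dist_awalk assms(2,3) by blast
  with walk show ?thesis by metis
qed

lemma graph_dist_self: "u \<in> pverts G \<Longrightarrow> graph_dist G u u = 0"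
  using graph_dist_le_length[OF pair_graph, of u "[]" u]
    lipschitz_le_graph_dist[of "\<lambda>_. 0" u u] by (simp add: awalk_Nil_iff)

lemma graph_dist_ge_1:
  assumes "u \<in> pverts G" and "v \<in> pverts G" and "u \<noteq> v"
  shows "graph_dist G u v \<ge> 1"
  using lipschitz_le_graph_dist[of "\<lambda>x. if x = v then 1 else 0" u v] assms by simp

lemma graph_dist_arc:
  assumes "(u, v) \<in> parcs G"
  shows "graph_dist G u v = 1"
proof (rule antisym)
  show "graph_dist G u v \<le> 1"
    using graph_dist_le_length[OF pair_graph, of u "[(u, v)]" v] assms in_arcsD1 in_arcsD2
    by (simp add: awalk_simps)
  show "1 \<le> graph_dist G u v"
    using assms graph_dist_ge_1 in_arcsD1 in_arcsD2 no_loops' by metis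
qed

lemma graph_dist_ge_2:
  assumes "u \<in> pverts G" and "v \<in> pverts G" and "u \<noteq> v" and "(u, v) \<notin> parcs G"
  shows "graph_dist G u v \<ge> 2"
proof -
  obtain p where p: "awalk u p v" "graph_dist G u v = real (length p)"
    using graph_dist_awalk assms(1,2) by blast
  have "p \<noteq> []" using p assms(3) by (auto simp: awalk_Nil_iff)
  moreover have "p \<noteq> [e]" for e using p assms(4) by (cases e) (auto simp: awalk_simps)
  ultimately have "length p \<ge> 2" by (cases p; cases "tl p") auto
  with p(2) show ?thesis by simp
qed

text \<open>The parent of \<open>v\<close> is the second vertex of a shortest walk from
  \<open>v\<close> to \<open>c\<close>. The convention that \<open>c\<close> is its own parent makes
  iterated parents stop at the root.\<close>

lemma rooted:
  assumes c: "c \<in> pverts G"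
  obtains \<delta> :: "'a \<Rightarrow> nat" and par where
    "\<And>v. v \<in> pverts G \<Longrightarrow> graph_dist G v c = real (\<delta> v)"
    "\<And>v. v \<in> pverts G \<Longrightarrow> v \<noteq> c \<Longrightarrow> (v, par v) \<in> parcs G \<and> \<delta> v = Suc (\<delta> (par v))"
    "par c = c"
proof -
  define \<delta> where "\<delta> v = nat \<lfloor>graph_dist G v c\<rfloor>" for v
  have \<delta>: "graph_dist G v c = real (\<delta> v)" if "v \<in> pverts G" for v
    using graph_dist_awalk[OF that c] unfolding \<delta>_def by (metis floor_of_nat nat_int)
  have "\<exists>w. (v, w) \<in> parcs G \<and> \<delta> v = Suc (\<delta> w)" if v: "v \<in> pverts G" "v \<noteq> c" for v
  proof -
    obtain p where p: "awalk v p c" "graph_dist G v c = real (length p)"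
      using graph_dist_awalk[OF v(1) c] by blast
    then obtain w q where q: "p = (v, w) # q"
      using v(2) by (cases p) (auto simp: awalk_simps)
    have arc: "(v, w) \<in> parcs G" and w: "awalk w q c" using p(1) unfolding q by (auto simp: awalk_simps)
    have wV: "w \<in> pverts G" using arc by (rule in_arcsD2)
    \<comment> \<open>One inequality comes from the tail of the shortest walk from \<open>v\<close>,
      the other from prolonging a shortest walk from \<open>w\<close> by the arc.\<close>
    have "\<delta> w \<le> length q"
      using graph_dist_le_length[OF pair_graph w] \<delta>[OF wV] by simp
    moreover obtain r where r: "awalk w r c" "graph_dist G w c = real (length r)"
      using graph_dist_awalk[OF wV c] by blast
    have "awalk v ((v, w) # r) c" using r(1) arc v(1) by (auto simp: awalk_simps)
    from graph_dist_le_length[OF pair_graph this] have "\<delta> v \<le> Suc (\<delta> w)"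
      using r(2) \<delta>[OF wV] \<delta>[OF v(1)] by simp
    ultimately show ?thesis using arc p(2) \<delta>[OF v(1)] unfolding q by (intro exI[of _ w]) simp
  qed
  then obtain par where "\<And>v. v \<in> pverts G \<Longrightarrow> v \<noteq> c \<Longrightarrow> (v, par v) \<in> parcs G \<and> \<delta> v = Suc (\<delta> (par v))"
    by metis
  with \<delta> that[of \<delta> "par(c := c)"] show ?thesis by simp
qed

end

section \<open>Parent arcs and branches in a tree\<close>

locale undirected_tree_graph = connected_pair_graph +
  assumes acyclic: "\<And>p. cycle p \<Longrightarrow> length p < 3"

lemma undirected_tree_graphI:
  "undirected_tree G \<Longrightarrow> undirected_tree_graph G"
  by (auto simp: undirected_tree_def undirected_tree_graph_def undirected_tree_graph_axioms_def
      connected_pair_graph_def connected_pair_graph_axioms_def not_le)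

text \<open>Root, depth and parent are parameters because a tree gets rooted twice: at an arbitrary
  vertex to find a branching vertex, then at the branching vertex.\<close>

locale rooted_tree = undirected_tree_graph +
  fixes c :: 'a and \<delta> :: "'a \<Rightarrow> nat" and par :: "'a \<Rightarrow> 'a"
  assumes root: "c \<in> pverts G"
    and dist_root: "\<And>v. v \<in> pverts G \<Longrightarrow> graph_dist G v c = real (\<delta> v)"
    and par: "\<And>v. v \<in> pverts G \<Longrightarrow> v \<noteq> c \<Longrightarrow> (v, par v) \<in> parcs G \<and> \<delta> v = Suc (\<delta> (par v))"
    and par_root: "par c = c"
begin

lemma depth_root: "\<delta> c = 0"
  using dist_root[OF root] graph_dist_self[OF root] by simp

lemma depth_eq_0: "v \<in> pverts G \<Longrightarrow> \<delta> v = 0 \<longleftrightarrow> v = c"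
  using par depth_root by fastforce

lemma par_in_verts: "v \<in> pverts G \<Longrightarrow> v \<noteq> c \<Longrightarrow> par v \<in> pverts G"
  using par in_arcsD2 by blast

text \<open>Since the walk consists of parent arcs only, \<open>arc_cases\<close> can tell that it
  misses a given arc.\<close>

lemma awalk_to_root:
  assumes "v \<in> pverts G"
  shows "\<exists>p. awalk v p c \<and> set p \<subseteq> {(w, par w) |w. w \<in> pverts G \<and> w \<noteq> c}"
  using assms
proof (induction "\<delta> v" arbitrary: v)
  case 0
  then have "v = c" using depth_eq_0 by simp
  then show ?case using root by (intro exI[of _ "[]"]) (simp add: awalk_Nil_iff)
next
  case (Suc k)
  then have "v \<noteq> c" using depth_root by auto
  with Suc have v: "(v, par v) \<in> parcs G" "k = \<delta> (par v)" "par v \<in> pverts G"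
    using par[of v] par_in_verts[of v] by auto
  then obtain p where "awalk (par v) p c" "set p \<subseteq> {(w, par w) |w. w \<in> pverts G \<and> w \<noteq> c}"
    using Suc.hyps(1) by blast
  then show ?case using v Suc.prems \<open>v \<noteq> c\<close>
    by (intro exI[of _ "(v, par v) # p"]) (auto simp: awalk_simps)
qed

lemma set_rev_path: "set (rev_path p) = (set p)\<inverse>"
  by (induction p) auto

text \<open>Otherwise the parent arcs join the ends of the arc by a path, and the arc closes a cycle.\<close>

lemma arc_cases:
  assumes "(a, b) \<in> parcs G"
  shows "(a \<noteq> c \<and> b = par a) \<or> (b \<noteq> c \<and> a = par b)"
proof (rule ccontr)
  assume neg: "\<not> ?thesis"
  let ?F = "{(w, par w) |w. w \<in> pverts G \<and> w \<noteq> c}"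
  have ab: "a \<in> pverts G" "b \<in> pverts G" "a \<noteq> b"
    using assms in_arcsD1 in_arcsD2 no_loops' by blast+
  obtain p q where p: "awalk a p c" "set p \<subseteq> ?F" and q: "awalk b q c" "set q \<subseteq> ?F"
    using awalk_to_root[OF ab(1)] awalk_to_root[OF ab(2)] by blast
  define r where "r = awalk_to_apath (q @ rev_path p)"
  have walk: "awalk b (q @ rev_path p) a"
    using q(1) p(1) by (intro awalk_appendI[of _ _ c]) simp_all
  have r: "apath b r a" unfolding r_def by (rule apath_awalk_to_apath[OF walk])
  have "set r \<subseteq> ?F \<union> ?F\<inverse>"
    using awalk_to_apath_subset[OF walk] p(2) q(2)
    unfolding r_def set_append set_rev_path by blast
  moreover have "(b, a) \<notin> ?F \<union> ?F\<inverse>" using neg by auto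
  ultimately have "(b, a) \<notin> set r" by blast
  \<comment> \<open>A path from \<open>b\<close> to \<open>a\<close> that avoids
    \<open>(b, a)\<close> has at least two arcs, so closing it with \<open>(a, b)\<close> gives a
    cycle of length at least 3.\<close>
  then have "r \<noteq> [e]" for e using r by (cases e) (auto simp: apath_def awalk_simps)
  moreover have "r \<noteq> []" using r ab(3) by (auto simp: apath_def awalk_simps)
  ultimately have "length r \<ge> 2" by (cases r; cases "tl r") auto
  moreover have "cycle ((a, b) # r)"
    using r assms ab unfolding cycle_def apath_def
    by (intro exI[of _ a]) (auto simp: awalk_simps)
  ultimately show False using acyclic by fastforce
qed

text \<open>The last hypothesis puts \<open>w\<close> outside the branch of \<open>u\<close>. A walk
  from \<open>u\<close> to \<open>w\<close> has to pass the root, which costs 1, and then descend to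
  the depth of \<open>w\<close>. A signed depth as Lipschitz function makes this precise.\<close>

lemma graph_dist_other_branch:
  assumes u: "u \<in> pverts G" "\<delta> u = 1" and w: "w \<in> pverts G" and nw: "\<And>k. (par ^^ k) w \<noteq> u"
  shows "graph_dist G u w \<ge> real (\<delta> w) + 1"
proof -
  define T where "T = {v. \<exists>k. (par ^^ k) v = u}"
  have uc: "u \<noteq> c" using u(2) depth_root by auto
  have pu: "par u = c" using par[OF u(1) uc] u(2) depth_eq_0 par_in_verts[OF u(1) uc] by auto
  have T: "v \<in> T \<longleftrightarrow> v = u \<or> par v \<in> T" for v
  proof
    assume "v \<in> T"
    then obtain k where "(par ^^ k) v = u" by (auto simp: T_def)
    then show "v = u \<or> par v \<in> T"
      by (cases k) (auto simp: T_def funpow_Suc_right simp del: funpow.simps(2))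
  next
    assume "v = u \<or> par v \<in> T"
    then show "v \<in> T"
    proof
      assume "par v \<in> T"
      then obtain k where "(par ^^ k) (par v) = u" by (auto simp: T_def)
      then have "(par ^^ Suc k) v = u" by (simp add: funpow_Suc_right del: funpow.simps(2))
      then show ?thesis unfolding T_def by blast
    qed (auto simp: T_def intro: exI[of _ 0])
  qed
  \<comment> \<open>Depth counted negatively on the branch of \<open>u\<close>: changes by 1 along every arc, by \<open>\<delta> w + 1\<close> from \<open>u\<close> to \<open>w\<close>.\<close>
  define h where "h v = (if v \<in> T then - real (\<delta> v) else real (\<delta> v))" for v
  \<comment> \<open>Of the parent arcs only the one from \<open>u\<close> to \<open>c\<close> leaves
    the branch, and there \<open>h\<close> takes the values -1 and 0.\<close>
  have "\<bar>h v - h (par v)\<bar> \<le> 1" if "v \<in> pverts G" "v \<noteq> c" for v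
    using par[OF that] T[of v] u(2) depth_root pu by (auto simp: h_def)
  then have "h b \<le> h a + 1" if "(a, b) \<in> parcs G" for a b
    using arc_cases[OF that] in_arcsD1[OF that] in_arcsD2[OF that] by (smt (verit, best))
  from lipschitz_le_graph_dist[of h, OF this u(1) w] have "h w - h u \<le> graph_dist G u w" .
  moreover have "w \<notin> T" using nw by (simp add: T_def)
  moreover have "u \<in> T" using T by blast
  ultimately show ?thesis using u(2) by (simp add: h_def)
qed

lemma depth_funpow_par:
  "v \<in> pverts G \<Longrightarrow> k \<le> \<delta> v \<Longrightarrow> (par ^^ k) v \<in> pverts G \<and> \<delta> ((par ^^ k) v) = \<delta> v - k"
proof (induction k)
  case (Suc k)
  then have IH: "(par ^^ k) v \<in> pverts G" "\<delta> ((par ^^ k) v) = \<delta> v - k" by auto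
  with Suc.prems have "(par ^^ k) v \<noteq> c" using depth_root by auto
  from par[OF IH(1) this] par_in_verts[OF IH(1) this] IH(2) show ?case by auto
qed simp

text \<open>Each step to the parent lowers the depth by 1 until the root, where the iteration stays.
  Hence no vertex lies on the branches of two children of the root.\<close>

lemma funpow_par_eqD:
  assumes v: "v \<in> pverts G" and u: "(par ^^ k) v = u" "\<delta> u = 1"
  shows "k = \<delta> v - 1"
proof (cases "k \<le> \<delta> v")
  case True
  then show ?thesis using depth_funpow_par[OF v True] u by simp
next
  case False
  have "(par ^^ \<delta> v) v = c" using depth_funpow_par[OF v, of "\<delta> v"] depth_eq_0 by auto
  moreover have "(par ^^ j) c = c" for j by (induction j) (auto simp: par_root)
  ultimately have "(par ^^ (k - \<delta> v + \<delta> v)) v = c" unfolding funpow_add by simp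
  with False u depth_root show ?thesis by simp
qed

text \<open>The arcs avoiding the root, each at distance 1, are outweighed by pairs at distance at least 3:
  pair every vertex of depth at least 2 with one of \<open>u1\<close>, \<open>u2\<close> on another branch.\<close>

lemma sum_graph_dist_off_root_ge:
  assumes u: "u1 \<in> pverts G" "u2 \<in> pverts G" "u1 \<noteq> u2" "\<delta> u1 = 1" "\<delta> u2 = 1"
  defines "W \<equiv> pverts G - {c}"
  shows "(\<Sum>a\<in>W. \<Sum>b\<in>W. graph_dist G a b) \<ge> 2 * real (card W) * (real (card W) - 1)"
proof -
  have fin: "finite W" using pair_finite_verts by (simp add: W_def)
  \<comment> \<open>A child of the root off the branch of \<open>a\<close>: \<open>u2\<close> if
    \<open>a\<close> lies on the branch of \<open>u1\<close>, and \<open>u1\<close>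
    otherwise.\<close>
  define far where "far a = (if \<exists>k. (par ^^ k) a = u1 then u2 else u1)" for a
  have far: "far a \<in> W \<and> \<delta> (far a) = 1" for a
    using u depth_root by (auto simp: far_def W_def)
  have dist_far: "graph_dist G a (far a) \<ge> 3" if a: "a \<in> pverts G" "\<delta> a \<ge> 2" for a
  proof -
    have "(par ^^ k) a \<noteq> far a" for k
      using funpow_par_eqD[OF a(1)] u by (auto simp: far_def)
    with graph_dist_other_branch[of "far a" a] far[of a] a
    show ?thesis by (simp add: W_def graph_dist_commute[OF pair_graph, of a])
  qed
  \<comment> \<open>For every \<open>a\<close> of depth at least 2, \<open>P\<close> marks the pair
    with its parent, which falls short of distance 2 by 1, and \<open>F\<close> marks the pair with
    \<open>far a\<close>, which exceeds 2 by at least 1.\<close>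
  define P where "P a b = (of_bool (\<delta> a \<ge> 2 \<and> b = par a) :: real)" for a b
  define F where "F a b = (of_bool (\<delta> a \<ge> 2 \<and> b = far a) :: real)" for a b
  have le: "(if a = b then 0 else 2) + F a b + F b a \<le> graph_dist G a b + P a b + P b a"
    if ab: "a \<in> W" "b \<in> W" for a b
  proof -
    have V: "a \<in> pverts G" "b \<in> pverts G" "a \<noteq> c" "b \<noteq> c" using ab by (auto simp: W_def)
    have P0: "P a b \<ge> 0" "P b a \<ge> 0" by (auto simp: P_def)
    \<comment> \<open>\<open>F a b\<close> asks for depth at least 2 at \<open>a\<close> and forces
      depth 1 at \<open>b\<close>, so a pair is marked in one order only.\<close>
    have excl: "F a b = 0 \<or> F b a = 0" "F a b \<le> 1" "F b a \<le> 1"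
      using far by (auto simp: F_def)
    have 3: "graph_dist G a b \<ge> 3" if "F a b \<noteq> 0 \<or> F b a \<noteq> 0"
      using that dist_far[OF V(1)] dist_far[OF V(2)] graph_dist_commute[OF pair_graph, of a b]
      by (auto simp: F_def)
    show ?thesis
    proof (cases "F a b \<noteq> 0 \<or> F b a \<noteq> 0")
      case True
      with 3 excl P0 show ?thesis by auto
    next
      case F: False
      consider "a = b" | "a \<noteq> b" "(a, b) \<notin> parcs G" | "(a, b) \<in> parcs G" "a \<noteq> b" by blast
      then show ?thesis
      proof cases
        case 1
        then show ?thesis using F P0 graph_dist_self[OF V(1)] by simp
      next
        case 2
        then show ?thesis using F P0 graph_dist_ge_2[OF V(1,2)] by simp
      next
        case 3
        \<comment> \<open>Off the root, an arc joins a vertex to a parent different from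
          \<open>c\<close>, so its lower end has depth at least 2.\<close>
        have "P a b = 1 \<or> P b a = 1"
          using arc_cases[OF 3(1)] par[OF V(1,3)] par[OF V(2,4)] depth_eq_0[OF V(1)] depth_eq_0[OF V(2)] V
          by (auto simp: P_def)
        then show ?thesis using F P0 graph_dist_arc[OF 3(1)] 3(2) by auto
      qed
    qed
  qed
  have sumP: "(\<Sum>b\<in>W. P a b) = of_bool (\<delta> a \<ge> 2)" if a: "a \<in> W" for a
  proof -
    have "par a \<in> W" if "\<delta> a \<ge> 2"
      using a that par[of a] par_in_verts[of a] depth_root by (auto simp: W_def)
    then show ?thesis using fin by (auto simp: P_def of_bool_def)
  qed
  have sumF: "(\<Sum>b\<in>W. F a b) = of_bool (\<delta> a \<ge> 2)" for a
    using fin far[of a] by (auto simp: F_def of_bool_def)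
  \<comment> \<open>Both sides count the vertices of \<open>W\<close> of depth at least 2, so
    deficits and surpluses cancel.\<close>
  have PF: "(\<Sum>a\<in>W. \<Sum>b\<in>W. P a b) = (\<Sum>a\<in>W. \<Sum>b\<in>W. F a b)"
    using sumP sumF by simp
  moreover have "(\<Sum>a\<in>W. \<Sum>b\<in>W. P b a) = (\<Sum>a\<in>W. \<Sum>b\<in>W. F b a)"
    unfolding sum.swap[of "\<lambda>a b. P b a"] sum.swap[of "\<lambda>a b. F b a"] by (rule PF)
  moreover have "(\<Sum>a\<in>W. \<Sum>b\<in>W. (if a = b then 0 else 2) + F a b + F b a)
      \<le> (\<Sum>a\<in>W. \<Sum>b\<in>W. graph_dist G a b + P a b + P b a)"
    by (intro sum_mono le)
  moreover have "(\<Sum>a\<in>W. \<Sum>b\<in>W. if a = b then 0 else 2) = (\<Sum>a\<in>W. 2 * (real (card W) - 1))"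
  proof (rule sum.cong[OF refl])
    fix a assume a: "a \<in> W"
    have "(\<Sum>b\<in>W. if a = b then 0 else 2) = (\<Sum>b\<in>W. 2 - (if a = b then 2 else (0::real)))"
      by (intro sum.cong) auto
    then show "(\<Sum>b\<in>W. if a = b then 0 else 2) = 2 * (real (card W) - 1)"
      using fin a by (simp add: sum_subtractf)
  qed
  ultimately show ?thesis by (simp add: sum.distrib) (simp add: algebra_simps)
qed

text \<open>All terms are at least 1 and the term of \<open>w\<close> is at least 2. This is the
  source of strictness in the comparison with the star.\<close>

lemma sum_graph_dist_root_gt:
  assumes w: "w \<in> pverts G" "\<delta> w \<ge> 2"
  shows "(\<Sum>v\<in>pverts G - {c}. graph_dist G c v) > real (card (pverts G)) - 1"
proof -
  have card: "real (card (pverts G)) - 1 = (\<Sum>v\<in>pverts G - {c}. 1)"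
    using root pair_finite_verts card_Suc_Diff1[of "pverts G" c] by (simp flip: of_nat_Suc)
  have ge: "1 \<le> graph_dist G c v" if "v \<in> pverts G - {c}" for v
    using that graph_dist_ge_1 root by auto
  have "w \<noteq> c" using w depth_root by auto
  with w have "w \<in> pverts G - {c}" "1 < graph_dist G c w"
    using dist_root[OF w(1)] graph_dist_commute[OF pair_graph, of c w] by auto
  then show "(\<Sum>v\<in>pverts G - {c}. graph_dist G c v) > real (card (pverts G)) - 1"
    unfolding card using ge pair_finite_verts by (intro sum_strict_mono_ex1) blast+
qed

text \<open>All arcs are parent arcs or their reverses, and here every parent is the root.\<close>

lemma arcs_if_depth_le_1:
  assumes "\<And>v. v \<in> pverts G \<Longrightarrow> \<delta> v \<le> 1"
  shows "parcs G = {c} \<times> (pverts G - {c}) \<union> (pverts G - {c}) \<times> {c}"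
proof -
  have p: "par v = c" if "v \<in> pverts G" "v \<noteq> c" for v
    using par[OF that] assms[OF that(1)] depth_eq_0[OF par_in_verts[OF that]] by simp
  have "(v, c) \<in> parcs G" if "v \<in> pverts G" "v \<noteq> c" for v
    using par[OF that] p[OF that] by simp
  moreover have "(a = c \<and> b \<noteq> c) \<or> (a \<noteq> c \<and> b = c)" if "(a, b) \<in> parcs G" for a b
    using arc_cases[OF that] p in_arcsD1[OF that] in_arcsD2[OF that] no_loops'[OF that] by metis
  ultimately have "(a, b) \<in> parcs G \<longleftrightarrow>
      a = c \<and> b \<in> pverts G \<and> b \<noteq> c \<or> b = c \<and> a \<in> pverts G \<and> a \<noteq> c" for a b
    using arcs_symmetric in_arcsD1 in_arcsD2 by metis
  then show ?thesis by auto
qed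

end

section \<open>Choice of the root\<close>

context undirected_tree_graph
begin

lemma rooted_tree_exists:
  assumes "c \<in> pverts G"
  obtains \<delta> par where "rooted_tree G c \<delta> par"
proof -
  obtain \<delta> par where "\<And>v. v \<in> pverts G \<Longrightarrow> graph_dist G v c = real (\<delta> v)"
    "\<And>v. v \<in> pverts G \<Longrightarrow> v \<noteq> c \<Longrightarrow> (v, par v) \<in> parcs G \<and> \<delta> v = Suc (\<delta> (par v))"
    "par c = c"
    using rooted[OF assms] by blast
  with assms have "rooted_tree G c \<delta> par" by unfold_locales auto
  with that show ?thesis .
qed

text \<open>Root the tree anywhere. The parent of a vertex \<open>w\<close> of depth at least 2 is
  adjacent to \<open>w\<close> and to its own parent, which differ in depth. If there is no such
  \<open>w\<close>, the root is adjacent to the at least two other vertices.\<close>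

lemma branching_vertex_exists:
  assumes "card (pverts G) \<ge> 3"
  obtains c u1 u2 where "(c, u1) \<in> parcs G" "(c, u2) \<in> parcs G" "u1 \<noteq> u2"
proof -
  from assms obtain r where r: "r \<in> pverts G" by fastforce
  obtain \<delta> par where "rooted_tree G r \<delta> par" using rooted_tree_exists[OF r] .
  then interpret rooted_tree G r \<delta> par .
  show ?thesis
  proof (cases "\<exists>w\<in>pverts G. \<delta> w \<ge> 2")
    case True
    then obtain w where w: "w \<in> pverts G" "\<delta> w \<ge> 2" by blast
    then have "w \<noteq> r" using depth_root by auto
    note 1 = par[OF w(1) this] par_in_verts[OF w(1) this]
    with w have "par w \<noteq> r" using depth_root by auto
    note 2 = par[OF 1(2) this]
    have "\<delta> w \<noteq> \<delta> (par (par w))" using 1 2 by linarith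
    then have "w \<noteq> par (par w)" by metis
    then show ?thesis using that 1 2 arcs_symmetric by blast
  next
    case False
    then have arcs: "parcs G = {r} \<times> (pverts G - {r}) \<union> (pverts G - {r}) \<times> {r}"
      by (intro arcs_if_depth_le_1) force
    have "card (pverts G - {r}) \<ge> 2" using assms r pair_finite_verts by simp
    then obtain u1 u2 where "u1 \<in> pverts G - {r}" "u2 \<in> pverts G - {r}" "u1 \<noteq> u2"
      by (auto simp: numeral_2_eq_2 card_le_Suc_iff)
    with arcs that show ?thesis by blast
  qed
qed

end

section \<open>Comparison with the star\<close>

context connected_pair_graph
begin

text \<open>Expanding the transmissions makes the form linear in the distances, so bounds on sums of
  distances carry over to it.\<close>

lemma gen_dist_quadratic_form:
  "(\<Sum>u\<in>pverts G. \<Sum>v\<in>pverts G. gen_dist \<alpha> G u v * z u * z v)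
    = (\<Sum>u\<in>pverts G. \<Sum>v\<in>pverts G. graph_dist G u v * (\<alpha> * (z u)\<^sup>2 + (1 - \<alpha>) * (z u * z v)))"
proof (rule sum.cong[OF refl])
  fix u assume u: "u \<in> pverts G"
  have "(\<Sum>v\<in>pverts G. gen_dist \<alpha> G u v * z u * z v)
      = (\<Sum>v\<in>pverts G. (if u = v then \<alpha> * transmission G u * (z u)\<^sup>2 else 0)
          + graph_dist G u v * ((1 - \<alpha>) * (z u * z v)))"
    by (intro sum.cong) (auto simp: gen_dist_def algebra_simps power2_eq_square)
  also have "\<dots> = \<alpha> * transmission G u * (z u)\<^sup>2
      + (\<Sum>v\<in>pverts G. graph_dist G u v * ((1 - \<alpha>) * (z u * z v)))"
    using u pair_finite_verts by (simp add: sum.distrib)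
  also have "\<alpha> * transmission G u * (z u)\<^sup>2 = (\<Sum>v\<in>pverts G. graph_dist G u v * (\<alpha> * (z u)\<^sup>2))"
    unfolding transmission_def by (simp add: sum_distrib_left sum_distrib_right mult_ac)
  finally show "(\<Sum>v\<in>pverts G. gen_dist \<alpha> G u v * z u * z v)
      = (\<Sum>v\<in>pverts G. graph_dist G u v * (\<alpha> * (z u)\<^sup>2 + (1 - \<alpha>) * (z u * z v)))"
    by (simp add: sum.distrib distrib_left)
qed

text \<open>A pair containing \<open>c\<close> occurs in both orders, with diagonal part \<alpha>
  x^2 in one and \<alpha> y^2 in the other. For pairs off \<open>c\<close> the coefficient collapses
  to y^2.\<close>

lemma gen_dist_quadratic_form_two_values:
  fixes x y :: real
  assumes c: "c \<in> pverts G"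
  defines "W \<equiv> pverts G - {c}" and "z \<equiv> \<lambda>v. if v = c then x else y"
  shows "(\<Sum>u\<in>pverts G. \<Sum>v\<in>pverts G. gen_dist \<alpha> G u v * z u * z v)
    = (\<Sum>v\<in>W. graph_dist G c v) * (\<alpha> * x\<^sup>2 + \<alpha> * y\<^sup>2 + 2 * (1 - \<alpha>) * x * y)
      + (\<Sum>u\<in>W. \<Sum>v\<in>W. graph_dist G u v) * y\<^sup>2"
proof -
  let ?f = "\<lambda>u v. graph_dist G u v * (\<alpha> * (z u)\<^sup>2 + (1 - \<alpha>) * (z u * z v))"
  have V: "pverts G = insert c W" "c \<notin> W" "finite W"
    using c pair_finite_verts by (auto simp: W_def)
  have "(\<Sum>u\<in>pverts G. \<Sum>v\<in>pverts G. ?f u v)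
      = (\<Sum>v\<in>W. ?f c v) + (\<Sum>u\<in>W. ?f u c) + (\<Sum>u\<in>W. \<Sum>v\<in>W. ?f u v)"
    unfolding V(1) using V(2,3) graph_dist_self[OF c] by (simp add: sum.distrib)
  also have "(\<Sum>v\<in>W. ?f c v) = (\<Sum>v\<in>W. graph_dist G c v) * (\<alpha> * x\<^sup>2 + (1 - \<alpha>) * (x * y))"
    unfolding sum_distrib_right using V(2) by (intro sum.cong) (auto simp: z_def)
  also have "(\<Sum>u\<in>W. ?f u c) = (\<Sum>v\<in>W. graph_dist G c v) * (\<alpha> * y\<^sup>2 + (1 - \<alpha>) * (y * x))"
    unfolding sum_distrib_right
  proof (rule sum.cong[OF refl])
    fix u assume "u \<in> W"
    then show "?f u c = graph_dist G c u * (\<alpha> * y\<^sup>2 + (1 - \<alpha>) * (y * x))"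
      using V(2) graph_dist_commute[OF pair_graph, of u c] by (auto simp: z_def)
  qed
  also have "(\<Sum>u\<in>W. \<Sum>v\<in>W. ?f u v) = (\<Sum>u\<in>W. \<Sum>v\<in>W. graph_dist G u v) * y\<^sup>2"
    unfolding sum_distrib_right using V(2)
    by (intro sum.cong) (auto simp: z_def algebra_simps power2_eq_square)
  finally show ?thesis unfolding gen_dist_quadratic_form by (simp add: algebra_simps)
qed

end

section \<open>The spectral radius of a star\<close>

definition star_value :: "real \<Rightarrow> nat \<Rightarrow> real" where
  "star_value \<alpha> n = (\<alpha> * real n + 2 * (real n - 2)
    + sqrt ((real n)\<^sup>2 * (2 - \<alpha>)\<^sup>2 + 4 * (real n - 1) * (2 * \<alpha> - 3))) / 2"

text \<open>The quotient matrix of the star: \<open>x\<close> and \<open>y\<close> are the entries of the Perron vector at the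
  centre and at the leaves.\<close>

lemma star_value_eigenvector:
  fixes n :: nat and \<alpha> :: real
  assumes n: "n \<ge> 2" and \<alpha>: "\<alpha> < 1"
  defines "m \<equiv> real n - 1" and "k \<equiv> star_value \<alpha> n"
  obtains x y where "x > 0" "y > 0"
    "\<alpha> * m * x + (1 - \<alpha>) * m * y = k * x"
    "(1 - \<alpha>) * x + (2 * (m - 1) + \<alpha>) * y = k * y"
proof -
  \<comment> \<open>The quotient matrix has rows (p, (1 - \<alpha>) m) and (1 - \<alpha>, q), and
    \<open>s\<close> is the root of its discriminant. So \<open>k\<close> is its larger
    eigenvalue.\<close>
  define p where "p = \<alpha> * m"
  define q where "q = 2 * (m - 1) + \<alpha>"
  define s where "s = sqrt ((p - q)\<^sup>2 + 4 * m * (1 - \<alpha>)\<^sup>2)"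
  have m: "m > 0" using n by (simp add: m_def)
  have pos: "4 * m * (1 - \<alpha>)\<^sup>2 > 0" using m \<alpha> by simp
  have s2: "s\<^sup>2 = (p - q)\<^sup>2 + 4 * m * (1 - \<alpha>)\<^sup>2"
    unfolding s_def using pos by (intro real_sqrt_pow2) (smt (verit) zero_le_power2)
  have "(real n)\<^sup>2 * (2 - \<alpha>)\<^sup>2 + 4 * (real n - 1) * (2 * \<alpha> - 3) = (p - q)\<^sup>2 + 4 * m * (1 - \<alpha>)\<^sup>2"
    unfolding p_def q_def m_def by (simp add: algebra_simps power2_eq_square)
  moreover have "\<alpha> * real n + 2 * (real n - 2) = p + q"
    unfolding p_def q_def m_def by (simp add: algebra_simps)
  ultimately have k: "k = (p + q + s) / 2"
    unfolding k_def star_value_def s_def by simp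
  \<comment> \<open>Since \<alpha> < 1, the product of the off-diagonal entries is positive, which
    makes \<open>k\<close> exceed \<open>q\<close>. This becomes the positivity of
    \<open>x\<close>.\<close>
  have "\<bar>p - q\<bar> < s"
    unfolding s_def using pos by (intro real_less_rsqrt) simp
  then have "k - q > 0" unfolding k by (simp add: abs_less_iff field_simps)
  moreover have "(k - p) * (k - q) = m * (1 - \<alpha>)\<^sup>2"
  proof -
    have "4 * ((k - p) * (k - q)) = s\<^sup>2 - (p - q)\<^sup>2"
      unfolding k by (simp add: field_simps power2_eq_square)
    then show ?thesis unfolding s2 by simp
  qed
  ultimately have "p * (k - q) + (1 - \<alpha>) * m * (1 - \<alpha>) = k * (k - q)"
    by (simp add: algebra_simps power2_eq_square)
  moreover have "(1 - \<alpha>) * (k - q) + q * (1 - \<alpha>) = k * (1 - \<alpha>)"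
    by (simp add: algebra_simps)
  \<comment> \<open>The vector (k - q, 1 - \<alpha>) solves the second row identically, and the
    first row is then the characteristic equation.\<close>
  ultimately show ?thesis
    using that[of "k - q" "1 - \<alpha>"] \<open>k - q > 0\<close> \<alpha> unfolding p_def[symmetric] q_def[symmetric] by simp
qed

text \<open>Stars are recognised by a centre and the exact arc set, so one computation of the radius
  covers both \<open>star n\<close> and every tree isomorphic to it, in place of transporting
  spectra along isomorphisms.\<close>

definition is_star_centre :: "'a pair_pre_digraph \<Rightarrow> 'a \<Rightarrow> bool" where
  "is_star_centre G c \<longleftrightarrow> c \<in> pverts G \<and>
    parcs G = {c} \<times> (pverts G - {c}) \<union> (pverts G - {c}) \<times> {c}"

lemma connected_if_star:
  assumes "pair_graph G" and c: "is_star_centre G c"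
  shows "connected_pair_graph G"
proof -
  interpret pair_graph G by fact
  have V: "c \<in> pverts G" and arcs: "(u, c) \<in> parcs G \<and> (c, u) \<in> parcs G"
    if "u \<in> pverts G" "u \<noteq> c" for u
    using c that by (auto simp: is_star_centre_def)
  have c: "c \<in> pverts G" using c by (simp add: is_star_centre_def)
  have reach: "u \<rightarrow>\<^sup>*\<^bsub>with_proj G\<^esub> c \<and> c \<rightarrow>\<^sup>*\<^bsub>with_proj G\<^esub> u" if "u \<in> pverts G" for u
    using arcs[OF that] that by (cases "u = c") auto
  have "strongly_connected (with_proj G)"
    using c reach by (auto simp: strongly_connected_def intro: reachable_trans)
  then have "Digraph_Component.connected (with_proj G)"
    by (auto simp: Digraph_Component.connected_def strongly_connected_def intro: reachable_mk_symmetricI)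
  then show ?thesis by unfold_locales
qed

text \<open>Leaves have distance 1 to the centre and 2 to each other, so the eigenvector of the
  quotient matrix lifts to a positive eigenvector, constant on the leaves.\<close>

lemma gen_distance_radius_star_centre:
  assumes G: "pair_graph G" and c: "is_star_centre G c"
    and n: "card (pverts G) = n" "n \<ge> 2" and \<alpha>: "0 \<le> \<alpha>" "\<alpha> < 1"
  shows "gen_distance_radius \<alpha> G = star_value \<alpha> n"
proof -
  interpret connected_pair_graph G by (rule connected_if_star[OF G c])
  define W where "W = pverts G - {c}"
  have V: "pverts G = insert c W" "c \<notin> W" "finite W"
    using c pair_finite_verts by (auto simp: W_def is_star_centre_def)
  have arcs: "parcs G = {c} \<times> W \<union> W \<times> {c}" using c by (simp add: is_star_centre_def W_def)
  define m where "m = real n - 1"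
  have m: "real (card W) = m" using n V by (simp add: m_def)
  have self: "graph_dist G u u = 0" if "u \<in> pverts G" for u using graph_dist_self[OF that] .
  have cw: "graph_dist G c v = 1" "graph_dist G v c = 1" if "v \<in> W" for v
    using graph_dist_arc arcs that by auto
  have ww: "graph_dist G u v = (if u = v then 0 else 2)" if uv: "u \<in> W" "v \<in> W" for u v
  proof (cases "u = v")
    case True
    then show ?thesis using self V uv by simp
  next
    case False
    have "awalk u [(u, c), (c, v)] v" using arcs uv V by (auto simp: awalk_simps)
    from graph_dist_le_length[OF pair_graph this] have "graph_dist G u v \<le> 2" by simp
    moreover have "graph_dist G u v \<ge> 2"
      by (rule graph_dist_ge_2) (use False arcs uv V in auto)
    ultimately show ?thesis using False by simp
  qed
  have sumw: "(\<Sum>v\<in>W. graph_dist G u v) = 2 * (m - 1)" if "u \<in> W" for u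
  proof -
    have "(\<Sum>v\<in>W. graph_dist G u v) = (\<Sum>v\<in>W. 2 - (if u = v then 2 else 0))"
      using ww[OF that] by (intro sum.cong) auto
    then show ?thesis using V that m by (simp add: sum_subtractf)
  qed
  have trc: "transmission G c = m"
    unfolding transmission_def V(1) using V m self[of c] cw by simp
  have trw: "transmission G u = 2 * (m - 1) + 1" if "u \<in> W" for u
    unfolding transmission_def V(1) using V sumw[OF that] cw(2)[OF that] by simp
  obtain x y where xy: "x > 0" "y > 0"
    "\<alpha> * m * x + (1 - \<alpha>) * m * y = star_value \<alpha> n * x"
    "(1 - \<alpha>) * x + (2 * (m - 1) + \<alpha>) * y = star_value \<alpha> n * y"
    using star_value_eigenvector[OF n(2) \<alpha>(2)] unfolding m_def by blast
  define w where "w v = (if v = c then x else y)" for v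
  have row: "(\<Sum>v\<in>pverts G. gen_dist \<alpha> G u v * w v) = \<alpha> * transmission G u * w u
      + (1 - \<alpha>) * (graph_dist G u c * x + (\<Sum>v\<in>W. graph_dist G u v) * y)"
    if "u \<in> pverts G" for u
  proof -
    have "(\<Sum>v\<in>pverts G. gen_dist \<alpha> G u v * w v)
      = (\<Sum>v\<in>pverts G. (if u = v then \<alpha> * transmission G u * w u else 0)
          + (1 - \<alpha>) * (graph_dist G u v * w v))"
      by (intro sum.cong) (auto simp: gen_dist_def algebra_simps)
    also have "\<dots> = \<alpha> * transmission G u * w u + (1 - \<alpha>) * (\<Sum>v\<in>pverts G. graph_dist G u v * w v)"
      using that pair_finite_verts by (simp add: sum.distrib sum_distrib_left)
    also have "(\<Sum>v\<in>pverts G. graph_dist G u v * w v)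
        = graph_dist G u c * x + (\<Sum>v\<in>W. graph_dist G u v * w v)"
      unfolding V(1) using V by (simp add: w_def)
    also have "(\<Sum>v\<in>W. graph_dist G u v * w v) = (\<Sum>v\<in>W. graph_dist G u v) * y"
      unfolding sum_distrib_right using V by (intro sum.cong) (auto simp: w_def)
    finally show ?thesis .
  qed
  show ?thesis
  proof (rule radius_eqI_positive_eigenvector[OF G])
    show "pverts G \<noteq> {}" using V by simp
    show "w u > 0" if "u \<in> pverts G" for u using xy by (simp add: w_def)
    show "gen_dist \<alpha> G u v \<ge> 0" if "u \<in> pverts G" "v \<in> pverts G" for u v
    proof -
      have d: "graph_dist G u v \<ge> 0" if "u \<in> pverts G" "v \<in> pverts G" for u v
        using self[of u] graph_dist_ge_1[OF that] by (cases "u = v") (auto simp: that)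
      then have "transmission G u \<ge> 0"
        unfolding transmission_def using that by (intro sum_nonneg) auto
      with d[OF that] \<alpha> show ?thesis
        unfolding gen_dist_def by (intro add_nonneg_nonneg mult_nonneg_nonneg) auto
    qed
    fix u assume "u \<in> pverts G"
    then consider "u = c" | "u \<in> W" using V by blast
    then show "(\<Sum>v\<in>pverts G. gen_dist \<alpha> G u v * w v) = star_value \<alpha> n * w u"
    proof cases
      case 1
      then show ?thesis using row[of c] V self[of c] trc cw m xy(3)
        by (simp add: w_def algebra_simps)
    next
      case 2
      then have "u \<noteq> c" using V by auto
      have "(\<Sum>v\<in>pverts G. gen_dist \<alpha> G u v * w v)
          = \<alpha> * (2 * (m - 1) + 1) * y + (1 - \<alpha>) * (x + 2 * (m - 1) * y)"
        using row[of u] 2 V(1) sumw[OF 2] trw[OF 2] cw(2)[OF 2] \<open>u \<noteq> c\<close>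
        by (simp add: w_def)
      also have "\<dots> = star_value \<alpha> n * y"
        unfolding xy(4)[symmetric] by (simp add: algebra_simps)
      finally show ?thesis using \<open>u \<noteq> c\<close> by (simp add: w_def)
    qed
  qed
qed

section \<open>Isomorphism with \<open>star n\<close>\<close>

lemma star_centre_star: "n \<ge> 1 \<Longrightarrow> is_star_centre (star n) 0"
  by (auto simp: is_star_centre_def star_def)

text \<open>Forward, the centre is the preimage of 0. Backward, any bijection from the leaves onto
  \<open>{1..<n}\<close>, extended by sending the centre to 0, is an isomorphism.\<close>

lemma digraph_iso_star_iff:
  assumes G: "pair_graph G" and n: "card (pverts G) = n" "n \<ge> 1"
  shows "digraph_iso (with_proj G) (with_proj (star n)) \<longleftrightarrow> (\<exists>c. is_star_centre G c)"
proof
  interpret pair_graph G by fact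
  assume "digraph_iso (with_proj G) (with_proj (star n))"
  then obtain h where h: "digraph_isomorphism h" "with_proj (star n) = app_iso h (with_proj G)"
    by (auto simp: digraph_iso_def)
  define f where "f = iso_verts h"
  have inj: "inj_on f (pverts G)" and
    ends: "e \<in> parcs G \<Longrightarrow> f (fst e) = iso_tail h (iso_arcs h e) \<and> f (snd e) = iso_head h (iso_arcs h e)" for e
    using h(1) by (auto simp: digraph_isomorphism_def f_def)
  have "verts (with_proj (star n)) = f ` pverts G" "arcs (with_proj (star n)) = iso_arcs h ` parcs G"
    "tail (with_proj (star n)) = iso_tail h" "head (with_proj (star n)) = iso_head h"
    unfolding h(2) by (simp_all add: f_def)
  then have S: "{..<n} = f ` pverts G" "parcs (star n) = iso_arcs h ` parcs G"
    "fst = iso_tail h" "snd = iso_head h"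
    by (simp_all add: star_def)
  \<comment> \<open>An isomorphism also carries its own arc map and end functions. As the image is
    \<open>star n\<close>, these end functions are \<open>fst\<close> and \<open>snd\<close>, so the
    vertex map determines the arc map.\<close>
  have iso: "iso_arcs h e = (f (fst e), f (snd e))" if "e \<in> parcs G" for e
    using ends[OF that] unfolding S(3,4)[symmetric] by simp
  have "0 \<in> f ` pverts G" using n(2) unfolding S(1)[symmetric] by simp
  then obtain c where c: "c \<in> pverts G" "f c = 0" by auto
  have f0: "f v = 0 \<longleftrightarrow> v = c" if "v \<in> pverts G" for v
    using inj c that by (metis inj_onD)
  have sub: "a = c \<and> b \<noteq> c \<or> b = c \<and> a \<noteq> c" if "(a, b) \<in> parcs G" for a b
  proof -
    have "(f a, f b) \<in> parcs (star n)" using iso[OF that] S(2) that by force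
    then show ?thesis
      using f0[OF in_arcsD1[OF that]] f0[OF in_arcsD2[OF that]] by (auto simp: star_def)
  qed
  have sup: "(c, v) \<in> parcs G" if "v \<in> pverts G" "v \<noteq> c" for v
  proof -
    have "f v < n" using S(1) that by auto
    then have "(0, f v) \<in> parcs (star n)"
      using f0[OF that(1)] that(2) by (auto simp: star_def)
    then obtain e where e: "e \<in> parcs G" "(f (fst e), f (snd e)) = (0, f v)"
      unfolding S(2) using iso by auto
    then have "fst e \<in> pverts G" "snd e \<in> pverts G" using in_arcsD1 in_arcsD2 by (cases e, auto)+
    with e have "fst e = c" "snd e = v" using f0 inj that(1) by (auto dest: inj_onD)
    with e(1) show ?thesis by (metis prod.collapse)
  qed
  have "(a, b) \<in> parcs G \<longleftrightarrow>
      a = c \<and> b \<in> pverts G \<and> b \<noteq> c \<or> b = c \<and> a \<in> pverts G \<and> a \<noteq> c" for a b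
    using sub sup arcs_symmetric in_arcsD1 in_arcsD2 by metis
  then have "is_star_centre G c" using c(1) by (auto simp: is_star_centre_def)
  then show "\<exists>c. is_star_centre G c" ..
next
  interpret pair_graph G by fact
  assume "\<exists>c. is_star_centre G c"
  then obtain c where c: "c \<in> pverts G"
    and arcs: "parcs G = {c} \<times> (pverts G - {c}) \<union> (pverts G - {c}) \<times> {c}"
    by (auto simp: is_star_centre_def)
  have "card (pverts G - {c}) = card {1..<n}" using n c pair_finite_verts by simp
  then obtain g where g: "bij_betw g (pverts G - {c}) {1..<n}"
    using finite_same_card_bij[of "pverts G - {c}" "{1..<n}"] pair_finite_verts by blast
  define f where "f = g(c := 0)"
  have "bij_betw f (pverts G - {c}) {1..<n}"
    using g by (rule bij_betw_cong[THEN iffD1, rotated]) (auto simp: f_def)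
  then have im: "f ` (pverts G - {c}) = {1..<n}" and "inj_on f (pverts G - {c})"
    by (auto simp: bij_betw_def)
  moreover have fc: "f c = 0" by (simp add: f_def)
  ultimately have inj: "inj_on f (pverts G)"
    using c by (metis Diff_idemp atLeastLessThan_iff inj_on_insert insert_Diff not_one_le_zero)
  define h where "h = \<lparr>iso_verts = f, iso_arcs = map_prod f f, iso_head = snd, iso_tail = fst\<rparr>"
  have "parcs G \<subseteq> pverts G \<times> pverts G" using in_arcsD1 in_arcsD2 by auto
  then have "inj_on (map_prod f f) (parcs G)"
    using map_prod_inj_on[OF inj inj] by (rule inj_on_subset[rotated])
  then have "digraph_isomorphism h"
    unfolding digraph_isomorphism_def using inj wf_digraph_axioms by (simp add: h_def)
  moreover have "f ` pverts G = {..<n}"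
  proof -
    have "f ` pverts G = insert 0 {1..<n}" using im fc c by (metis image_insert insert_Diff)
    then show ?thesis using n(2) by auto
  qed
  moreover have "map_prod f f ` parcs G = parcs (star n)"
  proof -
    have "map_prod f f ` (A \<times> B) = f ` A \<times> f ` B" for A B by force
    then show ?thesis unfolding arcs image_Un by (simp add: im fc star_def)
  qed
  ultimately have "with_proj (star n) = app_iso h (with_proj G)"
    by (intro pre_digraph.equality) (simp_all add: app_iso_def with_proj_def h_def star_def)
  with \<open>digraph_isomorphism h\<close> show "digraph_iso (with_proj G) (with_proj (star n))"
    unfolding digraph_iso_def by blast
qed

text \<open>Two neighbours of \<open>c\<close> give the estimate for pairs off the root. As
  \<open>c\<close> is no star centre, some vertex has depth at least 2, and the estimate at the root
  is strict.\<close>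

lemma star_value_less_radius:
  assumes G: "undirected_tree G" and n: "card (pverts G) = n" "n \<ge> 3" and \<alpha>: "0 \<le> \<alpha>" "\<alpha> < 1"
    and nonstar: "\<nexists>c. is_star_centre G c"
  shows "star_value \<alpha> n < gen_distance_radius \<alpha> G"
proof -
  interpret undirected_tree_graph G by (rule undirected_tree_graphI[OF G])
  obtain c u1 u2 where u: "(c, u1) \<in> parcs G" "(c, u2) \<in> parcs G" "u1 \<noteq> u2"
    using branching_vertex_exists n by metis
  have c: "c \<in> pverts G" using u(1) by (rule in_arcsD1)
  obtain \<delta> par where "rooted_tree G c \<delta> par" using rooted_tree_exists[OF c] .
  then interpret rooted_tree G c \<delta> par .
  have uV: "u1 \<in> pverts G" "u2 \<in> pverts G" using u in_arcsD2 by auto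
  have "\<delta> u1 = 1" "\<delta> u2 = 1"
    using dist_root uV graph_dist_arc[OF arcs_symmetric] u(1,2) by (metis of_nat_eq_1_iff)+
  note off = sum_graph_dist_off_root_ge[OF uV u(3) this]
  define m where "m = real n - 1"
  have card: "real (card (pverts G - {c})) = m"
    using c n pair_finite_verts card_Suc_Diff1[of "pverts G" c] by (simp add: m_def flip: of_nat_Suc)
  have "\<exists>w\<in>pverts G. \<delta> w \<ge> 2"
  proof (rule ccontr)
    assume "\<not> ?thesis"
    then have "is_star_centre G c"
      unfolding is_star_centre_def using c by (intro conjI arcs_if_depth_le_1) force+
    with nonstar show False by blast
  qed
  then have at_root: "(\<Sum>v\<in>pverts G - {c}. graph_dist G c v) > m"
    using sum_graph_dist_root_gt n by (auto simp: m_def)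
  have "n \<ge> 2" using n(2) by simp
  then obtain x y where xy: "x > 0" "y > 0"
    "\<alpha> * m * x + (1 - \<alpha>) * m * y = star_value \<alpha> n * x"
    "(1 - \<alpha>) * x + (2 * (m - 1) + \<alpha>) * y = star_value \<alpha> n * y"
    using star_value_eigenvector[of n, OF _ \<alpha>(2)] unfolding m_def by blast
  define z where "z v = (if v = c then x else y)" for v
  have N: "(\<Sum>u\<in>pverts G. (z u)\<^sup>2) = x\<^sup>2 + m * y\<^sup>2"
  proof -
    have "(\<Sum>u\<in>pverts G. (z u)\<^sup>2) = x\<^sup>2 + (\<Sum>u\<in>pverts G - {c}. (z u)\<^sup>2)"
      using c pair_finite_verts by (simp add: sum.remove z_def)
    also have "(\<Sum>u\<in>pverts G - {c}. (z u)\<^sup>2) = (\<Sum>u\<in>pverts G - {c}. y\<^sup>2)"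
      by (intro sum.cong) (auto simp: z_def)
    finally show ?thesis using card by simp
  qed
  let ?g = "\<alpha> * x\<^sup>2 + \<alpha> * y\<^sup>2 + 2 * (1 - \<alpha>) * x * y"
  \<comment> \<open>The mixed term is positive because \<alpha> < 1. Positivity of this coefficient
    carries the strict estimate at the root into the form.\<close>
  have g: "?g > 0"
    using xy \<alpha> by (intro add_nonneg_pos) auto
  \<comment> \<open>The two eigenvector equations, weighted by \<open>x\<close> and
    \<open>m * y\<close>, add up to the quadratic form of the star at its Perron vector.\<close>
  have "star_value \<alpha> n * (x\<^sup>2 + m * y\<^sup>2) = (star_value \<alpha> n * x) * x + m * ((star_value \<alpha> n * y) * y)"
    by (simp add: algebra_simps power2_eq_square)
  also have "\<dots> = m * ?g + 2 * m * (m - 1) * y\<^sup>2"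
    unfolding xy(3,4)[symmetric] by (simp add: algebra_simps power2_eq_square)
  also have "\<dots> < (\<Sum>v\<in>pverts G - {c}. graph_dist G c v) * ?g
      + (\<Sum>u\<in>pverts G - {c}. \<Sum>v\<in>pverts G - {c}. graph_dist G u v) * y\<^sup>2"
    using at_root g off unfolding card
    by (intro add_less_le_mono mult_strict_right_mono mult_right_mono) auto
  also have "\<dots> = (\<Sum>u\<in>pverts G. \<Sum>v\<in>pverts G. gen_dist \<alpha> G u v * z u * z v)"
    using gen_dist_quadratic_form_two_values[OF c, of \<alpha> x y] by (simp add: z_def)
  also have "\<dots> \<le> gen_distance_radius \<alpha> G * (x\<^sup>2 + m * y\<^sup>2)"
    unfolding N[symmetric] using c by (intro quadratic_form_le_radius pair_graph) auto
  finally have lt: "star_value \<alpha> n * (x\<^sup>2 + m * y\<^sup>2) < gen_distance_radius \<alpha> G * (x\<^sup>2 + m * y\<^sup>2)" .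
  have "x\<^sup>2 + m * y\<^sup>2 > 0" using xy n by (intro add_pos_nonneg) (auto simp: m_def)
  with lt show ?thesis by (simp add: mult_less_cancel_right)
qed

theorem theorem3p4:
  fixes G :: "'a pair_pre_digraph" and n :: nat and \<alpha> :: real
  assumes "undirected_tree G"
    and "card (pverts G) = n"
    and "n \<ge> 4"
    and "0 \<le> \<alpha>" and "\<alpha> < 1"
  shows "gen_distance_radius \<alpha> G \<ge> gen_distance_radius \<alpha> (star n)
    \<and> gen_distance_radius \<alpha> (star n) =
        (\<alpha> * real n + 2 * (real n - 2)
          + sqrt ((real n)\<^sup>2 * (2 - \<alpha>)\<^sup>2 + 4 * (real n - 1) * (2 * \<alpha> - 3))) / 2
    \<and> (gen_distance_radius \<alpha> G = gen_distance_radius \<alpha> (star n)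
        \<longleftrightarrow> digraph_iso (with_proj G) (with_proj (star n)))"
proof -
  have G: "pair_graph G" using assms(1) by (simp add: undirected_tree_def)
  have "card (pverts (star n)) = n" by (simp add: star_def)
  then have star: "gen_distance_radius \<alpha> (star n) = star_value \<alpha> n"
    using gen_distance_radius_star_centre[OF pair_graph_star star_centre_star] assms(3-5) by simp
  have iso: "digraph_iso (with_proj G) (with_proj (star n)) \<longleftrightarrow> (\<exists>c. is_star_centre G c)"
    using digraph_iso_star_iff[OF G assms(2)] assms(3) by simp
  show ?thesis
  \<comment> \<open>Stars attain \<open>star_value\<close> and all other trees exceed it strictly,
    which settles the bound and the equality case together.\<close>
  proof (cases "\<exists>c. is_star_centre G c")
    case True
    then have "gen_distance_radius \<alpha> G = star_value \<alpha> n"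
      using gen_distance_radius_star_centre[OF G _ assms(2)] assms(3-5) by auto
    with True show ?thesis unfolding iso star by (simp add: star_value_def)
  next
    case False
    then have "star_value \<alpha> n < gen_distance_radius \<alpha> G"
      using star_value_less_radius[OF assms(1,2)] assms(3-5) by simp
    with False show ?thesis unfolding iso star by (simp add: star_value_def)
  qed
qed

end
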